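(* Let $(\mathbb{R}^k,\|\cdot\|)$ be a smooth Minkowski space, and let $w:[0,\infty)\to\mathbb{R}$ be a weight function such that $w(0)\ge 0$, $w(t)>0$ for all $t>0$, $w$ is non-decreasing, and $w$ is concave. Let $p_1,\dots,p_n\in\mathbb{R}^k$ be sources and $q\in\mathbb{R}^k$ a single sink, all different from the origin $o$, and let the flow demand at $p_i$ be $t_i>0$. For each $i$ let $p_i^\ast$ denote the dual vector of $p_i$, and let $q^\ast$ denote the dual vector of $q$. Then the Gilbert arborescence with edges $op_i$ ($i=1,\dots,n$) and $oq$, in which all flows are routed via the Steiner point $o$, is a minimum Gilbert arborescence (for the terminals $p_1,\dots,p_n,q$, the flow demands $t_1,\dots,t_n$ and the weight function $w$) if and only if $$\sum_{i=1}^n w(t_i)\,p_i^\ast + w\Big(\sum_{i=1}^n t_i\Big)q^\ast = o$$ and $$\Big\|\sum_{i\in I} w(t_i)\,p_i^\ast\Big\|^\ast\le w\Big(\sum_{i\in I} t_i\Big)\quad\text{for all } I\subseteq\{1,\dots,n\}.$$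
   Context: A Minkowski space is $\mathbb{R}^k$ endowed with a norm $\|\cdot\|$. With $\langle\cdot,\cdot\rangle$ the standard inner product, the dual norm is $\|z\|^\ast=\sup_{\|x\|\le 1}\langle z,x\rangle$. The space is smooth if the norm is differentiable at every $x\ne o$. In that case each $x\neq o$ has a unique dual vector $x^\ast$, i.e. a unique vector $x^\ast\in\mathbb{R}^k$ with $\langle x^\ast,x\rangle=\|x\|$ and $\|x^\ast\|^\ast=1$; it is the gradient of the norm at $x$. Gilbert arborescences: given a set of terminals consisting of sources $p_1,\dots,p_n$ with positive flow demands $t_1,\dots,t_n$ and a sink $q$, a Gilbert arborescence is a finite tree $T$ whose vertices are points of the space and include all the terminals, whose edges are straight segments, and in which the flow $t_i$ from $p_i$ is routed along the unique path of $T$ from $p_i$ to $q$; every edge lies on at least one of these paths. Vertices of $T$ that are not terminals are called Steiner points; they may be arbitrary points of the space, in any finite number. The total flow on an edge $e$ is $t_e=\sum t_i$, summed over all $i$ such that $e$ lies on the path from $p_i$ to $q$. The cost of an edge $e=xy$ is $w(t_e)\|x-y\|$, and the cost of $T$ is the sum of the costs of its edges. A minimum Gilbert arborescence is a Gilbert arborescence of minimum cost among all Gilbert arborescences with the same terminals, flow demands and weight function. *)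

theory Defs
  imports "HOL-Analysis.Analysis"
begin

section \<open>Smooth Minkowski spaces\<close>

text \<open>The norm of a Minkowski space is an arbitrary function \<open>N\<close> satisfying the norm axioms,
  unrelated to the Euclidean \<^const>\<open>norm\<close> of the type; \<open>\<bullet>\<close> is the standard inner product.\<close>

locale minkowski_space =
  fixes N :: "real ^ 'k \<Rightarrow> real"
  assumes N_eq_0_iff: "N x = 0 \<longleftrightarrow> x = 0"
    and N_scaleR: "N (c *\<^sub>R x) = \<bar>c\<bar> * N x"
    and N_triangle: "N (x + y) \<le> N x + N y"

locale smooth_minkowski_space = minkowski_space N for N :: "real ^ 'k \<Rightarrow> real" +
  assumes N_differentiable: "x \<noteq> 0 \<Longrightarrow> N differentiable (at x)"

definition dual_norm :: "(real ^ 'k \<Rightarrow> real) \<Rightarrow> real ^ 'k \<Rightarrow> real" where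
  "dual_norm N z = (SUP x\<in>{x. N x \<le> 1}. z \<bullet> x)"

text \<open>Meaningful only for \<open>x \<noteq> 0\<close> in a smooth space, where existence and uniqueness hold.\<close>

definition dual_vector :: "(real ^ 'k \<Rightarrow> real) \<Rightarrow> real ^ 'k \<Rightarrow> real ^ 'k" where
  "dual_vector N x = (THE z. z \<bullet> x = N x \<and> dual_norm N z = 1)"


section \<open>Finite trees\<close>

text \<open>Graphs are finite, simple and undirected: a vertex set \<open>V\<close> and a set \<open>E\<close> of two-element
  subsets of \<open>V\<close>. The predicate \<open>tree\<close> of the AFP entry \<open>Graph_Theory\<close> is not usable here: its
  \<open>forest\<close> only forbids directed cycles, and it counts going back and forth along an edge of a
  symmetric digraph as a cycle.\<close>

definition simple_graph :: "'a set \<Rightarrow> 'a set set \<Rightarrow> bool" where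
  "simple_graph V E \<longleftrightarrow> finite V \<and> (\<forall>e\<in>E. e \<subseteq> V \<and> card e = 2)"

definition path_edges :: "'a list \<Rightarrow> 'a set set" where
  "path_edges xs = {{xs ! i, xs ! Suc i} | i. Suc i < length xs}"

definition graph_path :: "'a set \<Rightarrow> 'a set set \<Rightarrow> 'a \<Rightarrow> 'a \<Rightarrow> 'a list \<Rightarrow> bool" where
  "graph_path V E u v xs \<longleftrightarrow>
     xs \<noteq> [] \<and> hd xs = u \<and> last xs = v \<and> distinct xs \<and> set xs \<subseteq> V \<and> path_edges xs \<subseteq> E"

definition graph_cycle :: "'a set \<Rightarrow> 'a set set \<Rightarrow> 'a list \<Rightarrow> bool" where
  "graph_cycle V E xs \<longleftrightarrow>
     length xs \<ge> 3 \<and> distinct xs \<and> set xs \<subseteq> V \<and> path_edges xs \<subseteq> E \<and> {last xs, hd xs} \<in> E"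

definition graph_connected :: "'a set \<Rightarrow> 'a set set \<Rightarrow> bool" where
  "graph_connected V E \<longleftrightarrow> V \<noteq> {} \<and> (\<forall>u\<in>V. \<forall>v\<in>V. \<exists>xs. graph_path V E u v xs)"

definition is_tree :: "'a set \<Rightarrow> 'a set set \<Rightarrow> bool" where
  "is_tree V E \<longleftrightarrow> simple_graph V E \<and> graph_connected V E \<and> \<not> (\<exists>xs. graph_cycle V E xs)"

text \<open>The unique path between two vertices of a tree.\<close>

definition tree_path :: "'a set \<Rightarrow> 'a set set \<Rightarrow> 'a \<Rightarrow> 'a \<Rightarrow> 'a list" where
  "tree_path V E u v = (THE xs. graph_path V E u v xs)"


section \<open>Gilbert arborescences\<close>

text \<open>The sources are \<open>p 1, \<dots>, p n\<close> with demands \<open>t 1, \<dots>, t n\<close>, and the sink is \<open>q\<close>. The vertices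
  in \<open>V\<close> other than the terminals are the Steiner points. Edges are straight segments, given by
  their pair of end points; different edges are allowed to cross or overlap geometrically.\<close>

definition edge_flow ::
  "nat \<Rightarrow> (nat \<Rightarrow> 'a) \<Rightarrow> (nat \<Rightarrow> real) \<Rightarrow> 'a \<Rightarrow> 'a set \<Rightarrow> 'a set set \<Rightarrow> 'a set \<Rightarrow> real" where
  "edge_flow n p t q V E e =
     (\<Sum>i\<in>{i \<in> {1..n}. e \<in> path_edges (tree_path V E (p i) q)}. t i)"

definition gilbert_arborescence ::
  "nat \<Rightarrow> (nat \<Rightarrow> real ^ 'k) \<Rightarrow> real ^ 'k \<Rightarrow> (real ^ 'k) set \<Rightarrow> (real ^ 'k) set set \<Rightarrow> bool" where
  "gilbert_arborescence n p q V E \<longleftrightarrow>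
     is_tree V E \<and> p ` {1..n} \<subseteq> V \<and> q \<in> V \<and>
     (\<forall>e\<in>E. \<exists>i\<in>{1..n}. e \<in> path_edges (tree_path V E (p i) q))"

definition edge_length :: "(real ^ 'k \<Rightarrow> real) \<Rightarrow> (real ^ 'k) set \<Rightarrow> real" where
  "edge_length N e = (THE l. \<exists>x y. e = {x, y} \<and> l = N (x - y))"

lemma (in minkowski_space) edge_length_eq: "edge_length N {x, y} = N (x - y)"
proof -
  have "N (y - x) = N (x - y)"
    using N_scaleR[of "-1" "x - y"] by simp
  then show ?thesis
    unfolding edge_length_def by (auto simp: doubleton_eq_iff)
qed

definition gilbert_cost ::
  "(real ^ 'k \<Rightarrow> real) \<Rightarrow> (real \<Rightarrow> real) \<Rightarrow> nat \<Rightarrow> (nat \<Rightarrow> real ^ 'k) \<Rightarrow> (nat \<Rightarrow> real) \<Rightarrow> real ^ 'k \<Rightarrow>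
   (real ^ 'k) set \<Rightarrow> (real ^ 'k) set set \<Rightarrow> real" where
  "gilbert_cost N w n p t q V E = (\<Sum>e\<in>E. w (edge_flow n p t q V E e) * edge_length N e)"

definition minimum_gilbert_arborescence ::
  "(real ^ 'k \<Rightarrow> real) \<Rightarrow> (real \<Rightarrow> real) \<Rightarrow> nat \<Rightarrow> (nat \<Rightarrow> real ^ 'k) \<Rightarrow> (nat \<Rightarrow> real) \<Rightarrow> real ^ 'k \<Rightarrow>
   (real ^ 'k) set \<Rightarrow> (real ^ 'k) set set \<Rightarrow> bool" where
  "minimum_gilbert_arborescence N w n p t q V E \<longleftrightarrow>
     gilbert_arborescence n p q V E \<and>
     (\<forall>V' E'. gilbert_arborescence n p q V' E' \<longrightarrow>
        gilbert_cost N w n p t q V E \<le> gilbert_cost N w n p t q V' E')"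

definition star_verts :: "nat \<Rightarrow> (nat \<Rightarrow> real ^ 'k) \<Rightarrow> real ^ 'k \<Rightarrow> (real ^ 'k) set" where
  "star_verts n p q = {0, q} \<union> p ` {1..n}"

definition star_edges :: "nat \<Rightarrow> (nat \<Rightarrow> real ^ 'k) \<Rightarrow> real ^ 'k \<Rightarrow> (real ^ 'k) set set" where
  "star_edges n p q = {{0, q}} \<union> (\<lambda>i. {0, p i}) ` {1..n}"


section \<open>Weight functions\<close>

text \<open>Only the values of \<open>w\<close> on \<open>[0, \<infinity>)\<close> are constrained.\<close>

definition weight_function :: "(real \<Rightarrow> real) \<Rightarrow> bool" where
  "weight_function w \<longleftrightarrow>
     w 0 \<ge> 0 \<and> (\<forall>t>0. w t > 0) \<and> mono_on {0..} w \<and> concave_on {0..} w"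

end

theory Submission
  imports Defs
begin

text \<open>The star consists of the segments from the origin to the terminals. Its optimality is a first
  order condition at the origin, and the two conditions of the theorem turn out to be strong enough
  for a global lower bound.

  Suppose that both conditions hold. In any arborescence, orient each edge towards the sink, so that
  the edge vectors along the path of source \<open>i\<close> add up to \<open>p i - q\<close>. Charge an edge that carries
  the sources in \<open>I\<close> with the functional \<open>\<Sum>i\<in>I. w (t i) *\<^sub>R dual_vector N (p i)\<close>. The dual norm of
  this functional is at most the weight of the edge, so it bounds the cost of the edge from below.
  Adding these bounds and exchanging the two sums telescopes them along the paths, and the total
  \<open>\<Sum>i. w (t i) *\<^sub>R dual_vector N (p i) \<bullet> (p i - q)\<close> depends only on the terminals
  (\<open>calibration_lower_bound\<close>). By the balance condition and \<open>dual_vector N x \<bullet> x = N x\<close> it is the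
  cost of the star (\<open>conditions_imp_minimum\<close>).

  Suppose that the star is minimum, and compare it with two kinds of perturbation. Moving the Steiner
  point from the origin to \<open>e *\<^sub>R u\<close> changes the cost to first order by \<open>- e\<close> times the inner product
  of \<open>u\<close> with the weighted sum of dual vectors; as this holds for every \<open>u\<close>, the sum vanishes
  (\<open>minimum_imp_balance\<close>). Routing only the sources in \<open>I\<close> through an extra Steiner point
  \<open>e *\<^sub>R u\<close> gains the corresponding part of this inner product, and costs the new edge,
  \<open>w (\<Sum>i\<in>I. t i) * N (e *\<^sub>R u)\<close>. That the gain never exceeds the cost is the dual norm bound for
  \<open>I\<close> (\<open>minimum_imp_dual_norm_le\<close>). The derivatives come from the identification of the dual
  vector with the gradient of the norm (\<open>dual_vector\<close>, \<open>first_variation\<close>).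

  The combinatorial part makes paths and flows in trees accessible. Paths in a tree are unique
  (\<open>graph_path_unique\<close>), which gives every edge a consistent orientation in the lower bound. The
  perturbed stars are built from a parent function, from which their paths, flows and costs can be
  read off (\<open>parent_tree_gilbert_arborescence\<close>, \<open>relay_star\<close>).\<close>

section \<open>Paths in trees\<close>

lemma path_edges_simps [simp]:
  "path_edges [] = {}"
  "path_edges [x] = {}"
  "path_edges (x # y # xs) = insert {x, y} (path_edges (y # xs))"
proof -
  show "path_edges (x # y # xs) = insert {x, y} (path_edges (y # xs))"
  proof (rule set_eqI, rule iffI)
    fix e assume "e \<in> path_edges (x # y # xs)"
    then obtain i where "e = {(x # y # xs) ! i, (x # y # xs) ! Suc i}" "Suc i < length (x # y # xs)"
      unfolding path_edges_def by blast
    then show "e \<in> insert {x, y} (path_edges (y # xs))"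
      unfolding path_edges_def by (cases i) auto
  next
    fix e assume "e \<in> insert {x, y} (path_edges (y # xs))"
    then consider "e = {x, y}"
      | i where "e = {(y # xs) ! i, (y # xs) ! Suc i}" "Suc i < length (y # xs)"
      unfolding path_edges_def by blast
    then show "e \<in> path_edges (x # y # xs)"
    proof cases
      case 1
      then show ?thesis unfolding path_edges_def by (auto intro!: exI[of _ 0])
    next
      case (2 i)
      then show ?thesis unfolding path_edges_def by (auto intro!: exI[of _ "Suc i"])
    qed
  qed
qed (simp_all add: path_edges_def)

lemma path_edges_append:
  "path_edges (xs @ y # ys) = path_edges (xs @ [y]) \<union> path_edges (y # ys)"
proof (induction xs)
  case (Cons x xs)
  then show ?case by (cases xs) auto
qed simp

lemma path_edges_Cons: "xs \<noteq> [] \<Longrightarrow> path_edges (x # xs) = insert {x, hd xs} (path_edges xs)"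
  by (cases xs) auto

lemma path_edges_snoc: "xs \<noteq> [] \<Longrightarrow> path_edges (xs @ [y]) = insert {last xs, y} (path_edges xs)"
  by (induction xs rule: induct_list012) auto

lemma path_edges_rev: "path_edges (rev xs) = path_edges xs"
proof (induction xs)
  case (Cons x xs)
  then show ?case
    by (cases "xs = []") (auto simp: path_edges_snoc path_edges_Cons last_rev)
qed simp

lemma path_edges_subset_set: "e \<in> path_edges xs \<Longrightarrow> e \<subseteq> set xs"
  by (auto simp: path_edges_def)

lemma graph_path_self: "graph_path V E u u xs \<Longrightarrow> xs = [u]"
  unfolding graph_path_def by (cases xs) (auto split: if_splits)

lemma graph_path_Cons:
  assumes "graph_path V E v w xs" "u \<in> V" "u \<notin> set xs" "{u, v} \<in> E"
  shows "graph_path V E u w (u # xs)"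
  using assms unfolding graph_path_def by (auto simp: path_edges_Cons)

lemma graph_path_rev: "graph_path V E u v xs \<Longrightarrow> graph_path V E v u (rev xs)"
  unfolding graph_path_def by (auto simp: path_edges_rev hd_rev last_rev)

lemma graph_path_tl:
  assumes "graph_path V E u w (u # xs)" "xs \<noteq> []"
  shows "graph_path V E (hd xs) w xs"
  using assms unfolding graph_path_def by (auto simp: path_edges_Cons)

text \<open>Follow the first path up to its first vertex on the second path, and return along the
  second path. The result has at least three vertices because the two paths start with different
  steps.\<close>

lemma diverging_paths_give_cycle:
  assumes xs: "graph_path V E u v (u # xs)" "xs \<noteq> []"
    and ys: "graph_path V E u v (u # ys)" "ys \<noteq> []"
    and diff: "hd xs \<noteq> hd ys"
  shows "\<exists>zs. graph_cycle V E zs"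
proof -
  have "last xs = v" "last ys = v"
    using xs ys unfolding graph_path_def by auto
  then have "\<exists>x\<in>set xs. x \<in> set ys"
    using xs(2) ys(2) last_in_set by metis
  \<comment> \<open>\<open>c\<close> is the first vertex of \<open>xs\<close> that lies on \<open>ys\<close>.\<close>
  then obtain A c A' where A: "xs = A @ c # A'" "c \<in> set ys" "\<forall>x\<in>set A. x \<notin> set ys"
    using split_list_first_prop[of xs "\<lambda>x. x \<in> set ys"] by blast
  then obtain B B' where B: "ys = B @ c # B'"
    by (meson split_list)
  let ?zs = "u # A @ c # rev B"
  have dist: "distinct ?zs"
    using xs(1) ys(1) A B unfolding graph_path_def by auto
  have len: "length ?zs \<ge> 3"
  proof -
    have "A \<noteq> [] \<or> B \<noteq> []" using diff A(1) B by auto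
    then show ?thesis by (cases A; cases B) auto
  qed
  have EA: "path_edges (u # A @ [c]) \<subseteq> E"
    using xs(1) A(1) path_edges_append[of "u # A" c A'] unfolding graph_path_def by auto
  have EB: "path_edges (u # B @ [c]) \<subseteq> E"
    using ys(1) B path_edges_append[of "u # B" c B'] unfolding graph_path_def by auto
  have "path_edges (c # rev B) = path_edges (B @ [c])"
    using path_edges_rev[of "B @ [c]"] by simp
  also have "\<dots> \<subseteq> E" using EB by (auto simp: path_edges_Cons)
  finally have "path_edges ?zs \<subseteq> E"
    using EA path_edges_append[of "u # A" c "rev B"] by auto
  moreover have "{last ?zs, hd ?zs} \<in> E"
    using EB by (cases B) (auto simp: insert_commute)
  moreover have "set ?zs \<subseteq> V"
    using xs(1) ys(1) A B unfolding graph_path_def by auto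
  ultimately show ?thesis
    using dist len unfolding graph_cycle_def by blast
qed

lemma graph_path_unique:
  assumes "\<not> (\<exists>zs. graph_cycle V E zs)"
    and "graph_path V E u v xs" "graph_path V E u v ys"
  shows "xs = ys"
  using assms(2,3)
proof (induction xs arbitrary: u ys)
  case Nil
  then show ?case by (simp add: graph_path_def)
next
  case (Cons x xs)
  have x: "x = u" using Cons.prems(1) by (simp add: graph_path_def)
  obtain ys' where ys: "ys = u # ys'"
    using Cons.prems(2) by (cases ys) (auto simp: graph_path_def)
  show ?case
  proof (cases "u = v")
    case True
    then show ?thesis using Cons.prems graph_path_self by metis
  next
    case False
    then have ne: "xs \<noteq> []" "ys' \<noteq> []"
      using Cons.prems x ys by (auto simp: graph_path_def)
    have "hd xs = hd ys'"
      using diverging_paths_give_cycle[of V E u v xs ys'] assms(1) Cons.prems x ys ne by blast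
    then have "xs = ys'"
      using Cons.IH graph_path_tl Cons.prems x ys ne by metis
    then show ?thesis using x ys by simp
  qed
qed

text \<open>Uniqueness turns the definite description in \<^const>\<open>tree_path\<close> into a value: any path that can
  be exhibited is the tree path.\<close>

lemma tree_path_eqI:
  assumes "is_tree V E" "graph_path V E u v xs"
  shows "tree_path V E u v = xs"
  unfolding tree_path_def
  using assms graph_path_unique by (intro the_equality) (auto simp: is_tree_def)

lemma tree_path:
  assumes "is_tree V E" "u \<in> V" "v \<in> V"
  shows "graph_path V E u v (tree_path V E u v)"
proof -
  obtain xs where "graph_path V E u v xs"
    using assms unfolding is_tree_def graph_connected_def by blast
  then show ?thesis using tree_path_eqI[OF assms(1)] by metis
qed

lemma is_tree_finite_edges: "is_tree V E \<Longrightarrow> finite E"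
  unfolding is_tree_def simple_graph_def
  by (meson PowI finite_Pow_iff finite_subset subsetI)

section \<open>Norms, dual norms and dual vectors\<close>

context minkowski_space
begin

lemma N_zero [simp]: "N 0 = 0"
  by (simp add: N_eq_0_iff)

lemma N_minus [simp]: "N (- x) = N x"
  using N_scaleR[of "-1" x] by simp

lemma N_minus_commute: "N (x - y) = N (y - x)"
  using N_minus[of "x - y"] by simp

lemma N_nonneg [simp]: "N x \<ge> 0"
  using N_triangle[of x "- x"] by simp

lemma N_pos: "x \<noteq> 0 \<Longrightarrow> N x > 0"
  using N_nonneg[of x] N_eq_0_iff[of x] by linarith

lemma N_sum_le: "N (sum f A) \<le> (\<Sum>x\<in>A. N (f x))"
proof (induction A rule: infinite_finite_induct)
  case (insert x A)
  then show ?case using N_triangle[of "f x" "sum f A"] by simp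
qed auto

lemma N_le_norm: "\<exists>C. \<forall>x. N x \<le> C * norm x"
proof (intro exI allI)
  fix x :: "real ^ 'k"
  have "N x = N (\<Sum>b\<in>Basis. (x \<bullet> b) *\<^sub>R b)" by (simp add: euclidean_representation)
  also have "\<dots> \<le> (\<Sum>b\<in>Basis. N ((x \<bullet> b) *\<^sub>R b))" by (rule N_sum_le)
  also have "\<dots> = (\<Sum>b\<in>Basis. \<bar>x \<bullet> b\<bar> * N b)" by (simp add: N_scaleR)
  also have "\<dots> \<le> (\<Sum>b\<in>Basis. norm x * N b)"
    by (intro sum_mono mult_right_mono Basis_le_norm) auto
  finally show "N x \<le> (\<Sum>b\<in>Basis. N b) * norm x"
    by (simp add: sum_distrib_left mult.commute)
qed

lemma continuous_on_N: "continuous_on S N"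
proof -
  obtain C where C: "\<And>x. N x \<le> C * norm x" using N_le_norm by blast
  have "C \<ge> 0"
  proof -
    obtain b :: "real ^ 'k" where "b \<in> Basis" using nonempty_Basis by blast
    then show ?thesis using order_trans[OF N_nonneg C[of b]] by simp
  qed
  moreover have "\<bar>N x - N y\<bar> \<le> C * norm (x - y)" for x y
    using N_triangle[of "x - y" y] N_triangle[of "y - x" x] C[of "x - y"] N_minus_commute[of x y]
    by simp
  ultimately have "C-lipschitz_on S N"
    by (auto intro!: lipschitz_onI simp: dist_norm)
  then show ?thesis by (rule lipschitz_on_continuous_on)
qed

text \<open>The continuous function \<open>N\<close> is bounded away from zero on the compact Euclidean unit sphere.\<close>

lemma norm_le_N: "\<exists>C. \<forall>x. norm x \<le> C * N x"
proof -
  have "\<exists>x\<in>sphere 0 1. \<forall>y\<in>sphere (0 :: real ^ 'k) 1. N x \<le> N y"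
  proof (rule continuous_attains_inf)
    obtain b :: "real ^ 'k" where "b \<in> Basis" using nonempty_Basis by blast
    then have "b \<in> sphere 0 1" by simp
    then show "sphere (0 :: real ^ 'k) 1 \<noteq> {}" by blast
  qed (simp_all add: continuous_on_N)
  then obtain a where a: "norm a = 1" "\<And>y. norm y = 1 \<Longrightarrow> N a \<le> N y" by auto
  have pos: "N a > 0" using a(1) by (intro N_pos) auto
  have "norm x \<le> (1 / N a) * N x" for x
  proof (cases "x = 0")
    case False
    have "N a \<le> N ((1 / norm x) *\<^sub>R x)" using False by (intro a(2)) simp
    also have "\<dots> = N x / norm x" by (simp add: N_scaleR)
    finally show ?thesis using False pos by (simp add: field_simps)
  qed simp
  then show ?thesis by blast
qed

text \<open>Needed because a supremum of reals has an unspecified value on unbounded sets. The unit ball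
  of \<open>N\<close> is bounded by equivalence of norms.\<close>

lemma bdd_above_dual: "bdd_above ((\<lambda>x. z \<bullet> x) ` {x. N x \<le> 1})"
proof -
  obtain C where C: "\<And>x. norm x \<le> C * N x" using norm_le_N by blast
  have "z \<bullet> x \<le> norm z * \<bar>C\<bar>" if "N x \<le> 1" for x
  proof -
    have "C * N x \<le> \<bar>C\<bar> * 1"
      using that by (intro mult_mono) auto
    then have "norm x \<le> \<bar>C\<bar>" using C[of x] by linarith
    then have "norm z * norm x \<le> norm z * \<bar>C\<bar>" by (intro mult_left_mono) auto
    then show ?thesis using norm_cauchy_schwarz[of z x] by linarith
  qed
  then show ?thesis by (auto simp: bdd_above_def)
qed

lemma inner_le_dual_norm: "z \<bullet> x \<le> dual_norm N z * N x"
proof (cases "x = 0")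
  case False
  then have pos: "N x > 0" by (rule N_pos)
  have "z \<bullet> ((1 / N x) *\<^sub>R x) \<le> dual_norm N z"
    unfolding dual_norm_def
    by (rule cSUP_upper[OF _ bdd_above_dual]) (use pos in \<open>simp add: N_scaleR\<close>)
  then show ?thesis using pos by (simp add: field_simps)
qed simp

lemma dual_norm_leI:
  assumes "\<And>x. z \<bullet> x \<le> c * N x" and "c \<ge> 0"
  shows "dual_norm N z \<le> c"
  unfolding dual_norm_def
proof (rule cSUP_least)
  have "(0 :: real ^ 'k) \<in> {x. N x \<le> 1}" by simp
  then show "{x. N x \<le> 1} \<noteq> {}" by blast
  fix x assume "x \<in> {x. N x \<le> 1}"
  then have "c * N x \<le> c * 1" using assms(2) by (intro mult_left_mono) auto
  then show "z \<bullet> x \<le> c" using assms(1)[of x] by simp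
qed

text \<open>The reason why dual vectors are unique: \<open>N y - z \<bullet> y\<close> is minimal at \<open>y = x\<close>, so its
  derivative vanishes there.\<close>

lemma supporting_functional_eq_derivative:
  assumes D: "(N has_derivative D) (at x)" and z: "\<And>y. z \<bullet> y \<le> N y" "z \<bullet> x = N x"
  shows "D = (\<lambda>h. z \<bullet> h)"
proof -
  have "((\<lambda>y. N y - z \<bullet> y) has_derivative (\<lambda>h. D h - z \<bullet> h)) (at x)"
    by (intro derivative_intros D)
  then have zero: "(\<lambda>h. D h - z \<bullet> h) = (\<lambda>h. 0)"
    by (rule differential_zero_maxmin[of x UNIV, rotated 2]) (use z in auto)
  have "D h = z \<bullet> h" for h using fun_cong[OF zero, of h] by simp
  then show ?thesis by blast
qed

end

context smooth_minkowski_space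
begin

text \<open>Homogeneity along the ray through \<open>x\<close> gives \<open>g \<bullet> x = N x\<close>. The triangle inequality bounds the
  growth of the norm in direction \<open>h\<close> by \<open>N h\<close>, and so the directional derivative \<open>g \<bullet> h\<close>.\<close>

lemma gradient_supports:
  assumes "x \<noteq> 0"
  obtains g where "(N has_derivative (\<lambda>h. g \<bullet> h)) (at x)" "g \<bullet> x = N x" "\<And>y. g \<bullet> y \<le> N y"
proof -
  obtain D where D: "(N has_derivative D) (at x)"
    using N_differentiable[OF assms] unfolding differentiable_def by blast
  then have lin: "linear D" by (rule has_derivative_linear)
  define g where "g = (\<Sum>b\<in>Basis. D b *\<^sub>R b)"
  have g: "D h = g \<bullet> h" for h
  proof -
    have "D h = D (\<Sum>b\<in>Basis. (h \<bullet> b) *\<^sub>R b)" by (simp add: euclidean_representation)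
    also have "\<dots> = (\<Sum>b\<in>Basis. (h \<bullet> b) * D b)"
      by (simp add: linear_sum[OF lin] linear_cmul[OF lin])
    also have "\<dots> = g \<bullet> h"
      by (simp add: g_def inner_sum_left mult.commute inner_commute[of h])
    finally show ?thesis .
  qed
  have deriv: "((\<lambda>e. N (x + e *\<^sub>R h)) has_real_derivative g \<bullet> h) (at 0)" for h
  proof -
    have "((\<lambda>e. N (x + e *\<^sub>R h)) has_derivative (\<lambda>e. D (e *\<^sub>R h))) (at 0)"
      by (rule has_derivative_compose[of "\<lambda>e. x + e *\<^sub>R h" "\<lambda>e. e *\<^sub>R h"])
        (use D in \<open>auto intro!: derivative_eq_intros\<close>)
    moreover have "(\<lambda>e. D (e *\<^sub>R h)) = (*) (g \<bullet> h)"
      by (auto simp: g)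
    ultimately show ?thesis
      unfolding has_field_derivative_def by simp
  qed
  have "g \<bullet> h \<le> N h" for h
  proof (rule ccontr)
    assume neg: "\<not> g \<bullet> h \<le> N h"
    have "((\<lambda>e. N (x + e *\<^sub>R h) - e * N h) has_real_derivative g \<bullet> h - N h) (at 0)"
      by (auto intro!: derivative_eq_intros deriv)
    from DERIV_pos_inc_right[OF this] neg obtain d where d: "d > 0"
      "\<And>e. 0 < e \<Longrightarrow> e < d \<Longrightarrow> N x < N (x + e *\<^sub>R h) - e * N h" by auto
    have "N x < N (x + (d/2) *\<^sub>R h) - d/2 * N h" using d(2)[of "d/2"] d(1) by simp
    moreover have "N (x + (d/2) *\<^sub>R h) \<le> N x + d/2 * N h"
      using N_triangle[of x "(d/2) *\<^sub>R h"] d(1) by (simp add: N_scaleR)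
    ultimately show False by linarith
  qed
  moreover have "g \<bullet> x = N x"
  proof -
    have "((\<lambda>e. (1 + e) * N x) has_real_derivative N x) (at 0)"
      by (auto intro!: derivative_eq_intros)
    then have "((\<lambda>e. N (x + e *\<^sub>R x)) has_real_derivative N x) (at 0)"
    proof (rule has_field_derivative_transform_within_open[of _ _ _ "{-1<..<1}"])
      fix e :: real
      assume "e \<in> {-1<..<1}"
      moreover have "x + e *\<^sub>R x = (1 + e) *\<^sub>R x" by (simp add: algebra_simps)
      ultimately show "(1 + e) * N x = N (x + e *\<^sub>R x)" by (simp add: N_scaleR)
    qed auto
    then show ?thesis using deriv[of x] DERIV_unique by blast
  qed
  ultimately show ?thesis using that D g by (metis (no_types, lifting) ext)
qed

text \<open>The gradient is a dual vector by \<open>gradient_supports\<close>, and the only one because any dual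
  vector of \<open>x\<close> supports the norm at \<open>x\<close>.\<close>

lemma dual_vector:
  assumes "x \<noteq> 0"
  shows "(N has_derivative (\<lambda>h. dual_vector N x \<bullet> h)) (at x)"
    and "dual_vector N x \<bullet> x = N x"
proof -
  obtain g where g: "(N has_derivative (\<lambda>h. g \<bullet> h)) (at x)" "g \<bullet> x = N x" "\<And>y. g \<bullet> y \<le> N y"
    using gradient_supports[OF assms] by blast
  have "dual_norm N g \<le> 1" using g(3) by (intro dual_norm_leI) auto
  moreover have "dual_norm N g \<ge> 1"
    using inner_le_dual_norm[of g x] g(2) N_pos[OF assms] by simp
  ultimately have "dual_norm N g = 1" by simp
  moreover have "z = g" if z: "z \<bullet> x = N x" "dual_norm N z = 1" for z
  proof -
    have "z \<bullet> y \<le> N y" for y using inner_le_dual_norm[of z y] z(2) by simp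
    then have "(\<lambda>h. g \<bullet> h) = (\<lambda>h. z \<bullet> h)"
      using supporting_functional_eq_derivative[OF g(1)] z(1) by blast
    then show ?thesis by (metis vector_eq_rdot inner_commute)
  qed
  ultimately have "dual_vector N x = g"
    unfolding dual_vector_def using g(2) by (intro the_equality) blast+
  then show "(N has_derivative (\<lambda>h. dual_vector N x \<bullet> h)) (at x)" "dual_vector N x \<bullet> x = N x"
    using g(1,2) by simp_all
qed

text \<open>The one-sided condition of both perturbation arguments: the points \<open>x i\<close> stand for terminals,
  and \<open>e * b\<close> for the price of shifting their common neighbour by \<open>e *\<^sub>R u\<close>. If the conclusion
  failed, the right hand side of the assumption would have negative derivative at \<open>e = 0\<close>.\<close>

lemma first_variation:
  assumes "finite A" and nz: "\<And>i. i \<in> A \<Longrightarrow> x i \<noteq> 0"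
    and min: "eventually (\<lambda>e. (\<Sum>i\<in>A. c i * N (x i)) \<le> (\<Sum>i\<in>A. c i * N (x i - e *\<^sub>R u)) + e * b)
      (at_right 0)"
  shows "(\<Sum>i\<in>A. c i *\<^sub>R dual_vector N (x i)) \<bullet> u \<le> b"
proof (rule ccontr)
  define z where "z = (\<Sum>i\<in>A. c i *\<^sub>R dual_vector N (x i))"
  define F where "F = (\<lambda>e. (\<Sum>i\<in>A. c i * N (x i - e *\<^sub>R u)) + e * b)"
  assume "\<not> (\<Sum>i\<in>A. c i *\<^sub>R dual_vector N (x i)) \<bullet> u \<le> b"
  then have neg: "b - z \<bullet> u < 0" by (simp add: z_def)
  have single: "((\<lambda>e. N (x i - e *\<^sub>R u)) has_real_derivative - (dual_vector N (x i) \<bullet> u)) (at 0)"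
    if "i \<in> A" for i
  proof -
    have "((\<lambda>e. N (x i - e *\<^sub>R u)) has_derivative (\<lambda>e. dual_vector N (x i) \<bullet> - (e *\<^sub>R u))) (at 0)"
      by (rule has_derivative_compose[of "\<lambda>e. x i - e *\<^sub>R u" "\<lambda>e. - (e *\<^sub>R u)"])
        (use dual_vector(1)[OF nz[OF that]] in \<open>auto intro!: derivative_eq_intros\<close>)
    moreover have "(\<lambda>e. dual_vector N (x i) \<bullet> - (e *\<^sub>R u)) = (*) (- (dual_vector N (x i) \<bullet> u))"
      by auto
    ultimately show ?thesis
      unfolding has_field_derivative_def by simp
  qed
  have "(F has_real_derivative (\<Sum>i\<in>A. c i * - (dual_vector N (x i) \<bullet> u)) + b) (at 0)"
    unfolding F_def
  proof (rule DERIV_add)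
    show "((\<lambda>e. \<Sum>i\<in>A. c i * N (x i - e *\<^sub>R u)) has_real_derivative
        (\<Sum>i\<in>A. c i * - (dual_vector N (x i) \<bullet> u))) (at 0)"
      by (intro DERIV_sum DERIV_cmult single)
  qed (auto intro!: derivative_eq_intros)
  moreover have "(\<Sum>i\<in>A. c i * - (dual_vector N (x i) \<bullet> u)) = - (z \<bullet> u)"
    unfolding z_def inner_sum_left sum_negf[symmetric] by (intro sum.cong) simp_all
  ultimately have "(F has_real_derivative b - z \<bullet> u) (at 0)" by simp
  from DERIV_neg_dec_right[OF this neg] obtain d where d: "d > 0"
    "\<And>e. 0 < e \<Longrightarrow> e < d \<Longrightarrow> F e < F 0" by auto
  obtain d' where d': "d' > 0" "\<And>e. 0 < e \<Longrightarrow> e < d' \<Longrightarrow> F 0 \<le> F e"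
    using min unfolding eventually_at_right_field F_def by auto
  have "min d d' / 2 > 0" "min d d' / 2 < d" "min d d' / 2 < d'" using d d' by auto
  then show False using d(2) d'(2) by (meson not_le)
qed

end

section \<open>Trees given by a parent function\<close>

text \<open>The function \<open>depth\<close> only witnesses that iterating \<open>parent\<close> is well-founded; it need not be the
  distance to the root.\<close>

locale parent_tree =
  fixes V :: "'a set" and root :: 'a and parent :: "'a \<Rightarrow> 'a" and depth :: "'a \<Rightarrow> nat"
  assumes finite_V: "finite V"
    and root_in: "root \<in> V"
    and parent_in: "v \<in> V - {root} \<Longrightarrow> parent v \<in> V"
    and depth_parent: "v \<in> V - {root} \<Longrightarrow> depth (parent v) < depth v"
begin

definition edges :: "'a set set" where
  "edges = (\<lambda>v. {v, parent v}) ` (V - {root})"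

text \<open>The list of all iterated parents of a vertex, down to the root.\<close>

inductive root_path :: "'a \<Rightarrow> 'a list \<Rightarrow> bool" where
  root: "root_path root [root]"
| step: "v \<in> V - {root} \<Longrightarrow> root_path (parent v) xs \<Longrightarrow> root_path v (v # xs)"

lemma depth_root: "v \<in> V - {root} \<Longrightarrow> depth root < depth v"
proof (induction "depth v" arbitrary: v rule: less_induct)
  case less
  show ?case
  proof (cases "parent v = root")
    case True
    then show ?thesis using depth_parent[OF less.prems] by simp
  next
    case False
    then have "depth root < depth (parent v)"
      using less depth_parent parent_in by blast
    then show ?thesis using depth_parent[OF less.prems] by simp
  qed
qed

lemma edge_in: "v \<in> V - {root} \<Longrightarrow> {v, parent v} \<in> edges"
  by (auto simp: edges_def)

text \<open>Each edge is oriented by depth, so only the parent can be a neighbour that is not deeper.\<close>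

lemma lower_neighbour_is_parent:
  assumes "{x, y} \<in> edges" "depth y \<le> depth x"
  shows "y = parent x"
proof -
  obtain v where v: "v \<in> V - {root}" "{x, y} = {v, parent v}"
    using assms(1) unfolding edges_def by blast
  then have "x = v \<and> y = parent v \<or> x = parent v \<and> y = v" by (simp add: doubleton_eq_iff)
  then show ?thesis using depth_parent[OF v(1)] assms(2) by auto
qed

lemma inj_on_edge: "inj_on (\<lambda>v. {v, parent v}) (V - {root})"
proof (rule inj_onI)
  fix u v assume uv: "u \<in> V - {root}" "v \<in> V - {root}" "{u, parent u} = {v, parent v}"
  then have "u = v \<or> u = parent v \<and> parent u = v" by (auto simp: doubleton_eq_iff)
  then show "u = v" using depth_parent[OF uv(1)] depth_parent[OF uv(2)] by auto
qed

lemma simple: "simple_graph V edges"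
proof -
  have "e \<subseteq> V \<and> card e = 2" if e: "e \<in> edges" for e
  proof -
    obtain v where v: "v \<in> V - {root}" "e = {v, parent v}"
      using e unfolding edges_def by blast
    have "v \<noteq> parent v" using depth_parent[OF v(1)] by auto
    then show ?thesis using v parent_in[OF v(1)] by simp
  qed
  then show ?thesis unfolding simple_graph_def using finite_V by blast
qed

text \<open>Both neighbours of a deepest vertex of a cycle would be its parent, but they are different.\<close>

lemma acyclic: "\<not> graph_cycle V edges xs"
proof
  assume cyc: "graph_cycle V edges xs"
  define m where "m = length xs"
  have m: "m \<ge> 3" and dist: "distinct xs"
    using cyc by (auto simp: graph_cycle_def m_def)
  have step: "{xs ! j, xs ! Suc j} \<in> edges" if "Suc j < m" for j
    using cyc that unfolding graph_cycle_def path_edges_def m_def by blast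
  have close: "{xs ! (m - 1), xs ! 0} \<in> edges"
  proof -
    have "xs \<noteq> []" using m by (auto simp: m_def)
    then show ?thesis
      using cyc by (simp add: graph_cycle_def last_conv_nth hd_conv_nth m_def)
  qed
  \<comment> \<open>\<open>xs ! i\<close> is a deepest vertex of the cycle.\<close>
  have "Max (depth ` set xs) \<in> depth ` set xs"
    using m by (intro Max_in) (auto simp: m_def)
  then obtain i where i: "i < m" "Max (depth ` set xs) = depth (xs ! i)"
    by (auto simp: in_set_conv_nth m_def)
  then have top: "depth (xs ! j) \<le> depth (xs ! i)" if "j < m" for j
    using that Max_ge[of "depth ` set xs" "depth (xs ! j)"] by (simp add: m_def)
  define succ pred where "succ = (if Suc i = m then 0 else Suc i)"
    and "pred = (if i = 0 then m - 1 else i - 1)"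
  have lt: "succ < m" "pred < m" "succ \<noteq> pred"
    using m i(1) by (auto simp: succ_def pred_def)
  have "{xs ! i, xs ! succ} \<in> edges"
    using step[of i] close i(1) by (cases "Suc i = m") (auto simp: succ_def)
  moreover have "{xs ! i, xs ! pred} \<in> edges"
    using step[of "i - 1"] close i(1) by (cases i) (auto simp: pred_def insert_commute)
  ultimately have "xs ! succ = xs ! pred"
    using lower_neighbour_is_parent top lt by metis
  then show False
    using dist lt by (simp add: nth_eq_iff_index_eq m_def)
qed

text \<open>Replace the deeper of the two end points by its parent and extend the path found for the new
  pair. The bound on the depths guarantees that the old end point does not occur on it.\<close>

lemma path_below:
  assumes "u \<in> V" "v \<in> V"
  shows "\<exists>xs. graph_path V edges u v xs \<and>
    (\<forall>x\<in>set xs. x = u \<or> x = v \<or> depth x < max (depth u) (depth v))"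
  using assms
proof (induction "depth u + depth v" arbitrary: u v rule: less_induct)
  case less
  have climb: "\<exists>xs. graph_path V edges u v xs \<and>
      (\<forall>x\<in>set xs. x = u \<or> x = v \<or> depth x < max (depth u) (depth v))"
    if uv: "u \<in> V" "v \<in> V" "u \<noteq> v" "depth v \<le> depth u"
      and IH: "\<exists>xs. graph_path V edges (parent u) v xs \<and>
        (\<forall>x\<in>set xs. x = parent u \<or> x = v \<or> depth x < max (depth (parent u)) (depth v))"
    for u v
  proof -
    have u: "u \<in> V - {root}" using uv depth_root[of v] by auto
    obtain xs where xs: "graph_path V edges (parent u) v xs"
      "\<forall>x\<in>set xs. x = parent u \<or> x = v \<or> depth x < max (depth (parent u)) (depth v)"
      using IH by blast
    have low: "x = v \<or> depth x < depth u" if "x \<in> set xs" for x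
      using xs(2) that depth_parent[OF u] uv(4) by (auto simp: less_max_iff_disj)
    then have "graph_path V edges u v (u # xs)"
      using uv xs(1) edge_in[OF u] by (intro graph_path_Cons) auto
    then show ?thesis using low uv(4) by (intro exI[of _ "u # xs"]) auto
  qed
  consider "u = v" | "u \<noteq> v" "depth v \<le> depth u" | "u \<noteq> v" "depth u \<le> depth v" by linarith
  then show ?case
  proof cases
    case 1
    then show ?thesis using less.prems by (intro exI[of _ "[u]"]) (auto simp: graph_path_def)
  next
    case 2
    then have u: "u \<in> V - {root}" using depth_root[of v] less.prems by auto
    have "\<exists>xs. graph_path V edges (parent u) v xs \<and>
        (\<forall>x\<in>set xs. x = parent u \<or> x = v \<or> depth x < max (depth (parent u)) (depth v))"
      using depth_parent[OF u] parent_in[OF u] less.prems by (intro less.hyps) simp_all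
    then show ?thesis using climb[of u v] 2 less.prems by blast
  next
    case 3
    then have v: "v \<in> V - {root}" using depth_root[of u] less.prems by auto
    have "\<exists>xs. graph_path V edges u (parent v) xs \<and>
        (\<forall>x\<in>set xs. x = u \<or> x = parent v \<or> depth x < max (depth u) (depth (parent v)))"
      using depth_parent[OF v] parent_in[OF v] less.prems by (intro less.hyps) simp_all
    then obtain xs where xs: "graph_path V edges u (parent v) xs"
      "\<forall>x\<in>set xs. x = u \<or> x = parent v \<or> depth x < max (depth u) (depth (parent v))" by blast
    then have "\<exists>xs. graph_path V edges (parent v) u xs \<and>
        (\<forall>x\<in>set xs. x = parent v \<or> x = u \<or> depth x < max (depth (parent v)) (depth u))"
      by (intro exI[of _ "rev xs"]) (auto simp: graph_path_rev max.commute)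
    then obtain ys where "graph_path V edges v u ys"
      "\<forall>x\<in>set ys. x = v \<or> x = u \<or> depth x < max (depth v) (depth u)"
      using climb[of v u] 3 less.prems by blast
    then show ?thesis
      by (intro exI[of _ "rev ys"]) (auto simp: graph_path_rev max.commute)
  qed
qed

lemma is_tree: "is_tree V edges"
  unfolding is_tree_def graph_connected_def
  using simple acyclic root_in path_below by (metis empty_iff)

lemma root_path_graph_path:
  assumes "root_path v xs"
  shows "graph_path V edges v root xs \<and> (\<forall>x\<in>set xs. depth x \<le> depth v)"
  using assms
proof induction
  case root
  then show ?case using root_in by (auto simp: graph_path_def)
next
  case (step v xs)
  moreover from this have "v \<notin> set xs" using depth_parent[of v] by force
  ultimately show ?case
    using depth_parent[of v] edge_in[of v] by (auto intro: graph_path_Cons)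
qed

lemma tree_path_root_path: "root_path v xs \<Longrightarrow> tree_path V edges v root = xs"
  using root_path_graph_path tree_path_eqI[OF is_tree] by blast

text \<open>An edge of the tree is named by its lower end point \<open>v\<close>, so it carries exactly the sources
  whose path passes through \<open>v\<close>.\<close>

lemma edge_in_root_path_iff:
  assumes "root_path u xs" "v \<in> V - {root}"
  shows "{v, parent v} \<in> path_edges xs \<longleftrightarrow> v \<in> set xs"
  using assms
proof induction
  case (step u xs)
  have "xs \<noteq> []" "hd xs = parent u"
    using root_path_graph_path[OF step.hyps(2)] by (auto simp: graph_path_def)
  then have "{v, parent v} \<in> path_edges (u # xs) \<longleftrightarrow>
      {v, parent v} = {u, parent u} \<or> {v, parent v} \<in> path_edges xs"
    by (auto simp: path_edges_Cons)
  also have "\<dots> \<longleftrightarrow> v = u \<or> v \<in> set xs"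
    using step inj_onD[OF inj_on_edge, of v u] by auto
  finally show ?case by auto
qed auto

end

text \<open>The cost of a tree given by a parent function, as a sum over the lower end points of the
  edges. The lists \<open>P i\<close> make the flows explicit; that each vertex lies on one of them says that no
  edge is idle.\<close>

lemma parent_tree_gilbert_arborescence:
  fixes V :: "(real ^ 'k) set"
  assumes "parent_tree V q parent depth"
    and path: "\<And>i. i \<in> {1..n} \<Longrightarrow> parent_tree.root_path V q parent (p i) (P i)"
    and used: "\<And>v. v \<in> V - {q} \<Longrightarrow> \<exists>i\<in>{1..n}. v \<in> set (P i)"
  shows "gilbert_arborescence n p q V (parent_tree.edges V q parent)"
    and "gilbert_cost N w n p t q V (parent_tree.edges V q parent) =
      (\<Sum>v\<in>V - {q}. w (\<Sum>i\<in>{i \<in> {1..n}. v \<in> set (P i)}. t i) * edge_length N {v, parent v})"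
proof -
  interpret parent_tree V q parent depth by fact
  have tp: "tree_path V edges (p i) q = P i" if "i \<in> {1..n}" for i
    using path[OF that] by (rule tree_path_root_path)
  have on_path: "{v, parent v} \<in> path_edges (tree_path V edges (p i) q) \<longleftrightarrow> v \<in> set (P i)"
    if "i \<in> {1..n}" "v \<in> V - {q}" for i v
    using that edge_in_root_path_iff[OF path] tp by simp
  have "p i \<in> V" if "i \<in> {1..n}" for i
    using root_path_graph_path[OF path[OF that]] unfolding graph_path_def by (metis hd_in_set subsetD)
  moreover have "\<exists>i\<in>{1..n}. e \<in> path_edges (tree_path V edges (p i) q)" if "e \<in> edges" for e
    using that used on_path unfolding edges_def by blast
  ultimately show "gilbert_arborescence n p q V edges"
    using is_tree root_in unfolding gilbert_arborescence_def by auto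
  have "edge_flow n p t q V edges {v, parent v} = (\<Sum>i\<in>{i \<in> {1..n}. v \<in> set (P i)}. t i)"
    if "v \<in> V - {q}" for v
    unfolding edge_flow_def using on_path that by (intro sum.cong) auto
  then show "gilbert_cost N w n p t q V edges =
      (\<Sum>v\<in>V - {q}. w (\<Sum>i\<in>{i \<in> {1..n}. v \<in> set (P i)}. t i) * edge_length N {v, parent v})"
    unfolding gilbert_cost_def by (subst edges_def) (simp add: sum.reindex[OF inj_on_edge])
qed


section \<open>Stars with relay points\<close>

text \<open>A common shape for the star and for both of its perturbations, with hub \<open>c\<close> and relays \<open>r i\<close>
  between the sources and the hub. For the star all relays coincide with the hub; in the second
  perturbation some of them are split off.\<close>

definition relay_verts ::
  "nat \<Rightarrow> (nat \<Rightarrow> real ^ 'k) \<Rightarrow> real ^ 'k \<Rightarrow> real ^ 'k \<Rightarrow> (nat \<Rightarrow> real ^ 'k) \<Rightarrow> (real ^ 'k) set" where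
  "relay_verts n p q c r = {q, c} \<union> p ` {1..n} \<union> r ` {1..n}"

definition relay_edges ::
  "nat \<Rightarrow> (nat \<Rightarrow> real ^ 'k) \<Rightarrow> real ^ 'k \<Rightarrow> real ^ 'k \<Rightarrow> (nat \<Rightarrow> real ^ 'k) \<Rightarrow> (real ^ 'k) set set" where
  "relay_edges n p q c r =
     {{c, q}} \<union> (\<lambda>i. {p i, r i}) ` {1..n} \<union> (\<lambda>v. {v, c}) ` (r ` {1..n} - {c})"

text \<open>The three summands of the cost belong to the edge from hub to sink, the edges leaving the
  sources, and the edges from the proper relays to the hub. Keeping hub and relays away from the
  terminals makes the lower end points of these edges distinct, and different from the sink.\<close>

lemma (in minkowski_space) relay_star:
  assumes n: "n \<ge> 1" and inj: "inj_on p {1..n}" and q: "q \<notin> p ` {1..n}"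
    and c: "c \<notin> p ` {1..n}" "c \<noteq> q"
    and r: "\<And>i. i \<in> {1..n} \<Longrightarrow> r i \<notin> p ` {1..n}" "\<And>i. i \<in> {1..n} \<Longrightarrow> r i \<noteq> q"
  shows "gilbert_arborescence n p q (relay_verts n p q c r) (relay_edges n p q c r)"
    and "gilbert_cost N w n p t q (relay_verts n p q c r) (relay_edges n p q c r) =
      w (\<Sum>i\<in>{1..n}. t i) * N (c - q) + (\<Sum>i\<in>{1..n}. w (t i) * N (p i - r i)) +
      (\<Sum>v\<in>r ` {1..n} - {c}. w (\<Sum>i\<in>{i \<in> {1..n}. r i = v}. t i) * N (v - c))"
proof -
  define V where "V = relay_verts n p q c r"
  define parent where "parent v = (if v = c then q else
    if v \<in> p ` {1..n} then r (the_inv_into {1..n} p v) else c)" for v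
  \<comment> \<open>Levels: sink, hub, proper relays, sources.\<close>
  define depth :: "real ^ 'k \<Rightarrow> nat" where "depth v = (if v = q then 0 else if v = c then 1 else
    if v \<in> p ` {1..n} then 3 else 2)" for v
  define P where "P i = (if r i = c then [p i, c, q] else [p i, r i, c, q])" for i
  have parent_c: "parent c = q" by (simp add: parent_def)
  have parent_p: "parent (p i) = r i" if "i \<in> {1..n}" for i
  proof -
    have "p i \<noteq> c" using that c by blast
    then show ?thesis
      using that the_inv_into_f_f[OF inj that] by (auto simp: parent_def)
  qed
  have parent_r: "parent (r i) = c" if "i \<in> {1..n}" "r i \<noteq> c" for i
    using that r by (auto simp: parent_def)
  have V_cases: "v = c \<or> v \<in> p ` {1..n} \<or> v \<in> r ` {1..n} - {c}" if "v \<in> V - {q}" for v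
    using that unfolding V_def relay_verts_def by blast
  have tree: "parent_tree V q parent depth"
  proof
    show "finite V" "q \<in> V" by (auto simp: V_def relay_verts_def)
    fix v assume v: "v \<in> V - {q}"
    from V_cases[OF v] show "parent v \<in> V"
      by (auto simp: V_def relay_verts_def parent_c parent_p parent_r)
    from V_cases[OF v] show "depth (parent v) < depth v"
      using c q r by (auto simp: parent_c parent_p parent_r) (auto simp: depth_def)
  qed
  interpret parent_tree V q parent depth by (rule tree)
  have p_V: "p i \<in> V - {q}" and r_V: "r i \<in> V - {q}" and c_V: "c \<in> V - {q}" if "i \<in> {1..n}" for i
    using that q r c by (auto simp: V_def relay_verts_def)
  have path: "root_path (p i) (P i)" if i: "i \<in> {1..n}" for i
  proof -
    have pc: "root_path c [c, q]"
      using root_path.step[OF c_V[OF i]] root_path.root by (simp add: parent_c)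
    then have "root_path (r i) (if r i = c then [c, q] else [r i, c, q])"
      using root_path.step[OF r_V[OF i], of "[c, q]"] by (simp add: parent_r[OF i])
    then show ?thesis
      using root_path.step[OF p_V[OF i]] by (auto simp: parent_p[OF i] P_def split: if_splits)
  qed
  have used: "\<exists>i\<in>{1..n}. v \<in> set (P i)" if "v \<in> V - {q}" for v
  proof -
    have "1 \<in> {1..n}" using n by simp
    then show ?thesis using V_cases[OF that] by (force simp: P_def)
  qed
  have V': "V - {q} = insert c (p ` {1..n} \<union> (r ` {1..n} - {c}))"
  proof -
    have "q \<notin> r ` {1..n}" using r by blast
    then show ?thesis using q c unfolding V_def relay_verts_def by blast
  qed
  have edges: "edges = relay_edges n p q c r"
  proof -
    have "(\<lambda>v. {v, parent v}) ` p ` {1..n} = (\<lambda>i. {p i, r i}) ` {1..n}"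
      unfolding image_image by (intro image_cong) (auto simp: parent_p)
    moreover have "(\<lambda>v. {v, parent v}) ` (r ` {1..n} - {c}) = (\<lambda>v. {v, c}) ` (r ` {1..n} - {c})"
      by (intro image_cong) (auto simp: parent_r)
    ultimately show ?thesis
      unfolding edges_def V' relay_edges_def image_insert image_Un by (auto simp: parent_c)
  qed
  show "gilbert_arborescence n p q (relay_verts n p q c r) (relay_edges n p q c r)"
    using parent_tree_gilbert_arborescence(1)[OF tree path used] edges V_def by simp
  let ?g = "\<lambda>v. w (\<Sum>i\<in>{i \<in> {1..n}. v \<in> set (P i)}. t i) * edge_length N {v, parent v}"
  have "gilbert_cost N w n p t q V edges = (\<Sum>v\<in>V - {q}. ?g v)"
    using parent_tree_gilbert_arborescence(2)[OF tree path used] .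
  also have "V - {q} = insert c (p ` {1..n} \<union> (r ` {1..n} - {c}))"
    by (rule V')
  also have "(\<Sum>v\<in>\<dots>. ?g v) = ?g c + ((\<Sum>v\<in>p ` {1..n}. ?g v) + (\<Sum>v\<in>r ` {1..n} - {c}. ?g v))"
  proof -
    have "c \<notin> p ` {1..n} \<union> (r ` {1..n} - {c})" using c by blast
    moreover have "p ` {1..n} \<inter> (r ` {1..n} - {c}) = {}"
    proof -
      have "v \<notin> p ` {1..n}" if v: "v \<in> r ` {1..n}" for v
        using v r(1) by (metis imageE)
      then show ?thesis by blast
    qed
    ultimately show ?thesis
      by (simp only: sum.insert sum.union_disjoint finite_UnI finite_imageI finite_Diff
          finite_atLeastAtMost not_False_eq_True)
  qed
  also have "?g c = w (\<Sum>i\<in>{1..n}. t i) * N (c - q)"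
  proof -
    have "{i \<in> {1..n}. c \<in> set (P i)} = {1..n}" by (auto simp: P_def)
    then show ?thesis by (simp only: parent_c edge_length_eq)
  qed
  also have "(\<Sum>v\<in>p ` {1..n}. ?g v) = (\<Sum>i\<in>{1..n}. w (t i) * N (p i - r i))"
  proof (subst sum.reindex[OF inj], rule sum.cong[OF refl])
    fix i assume i: "i \<in> {1..n}"
    have "{j \<in> {1..n}. p i \<in> set (P j)} = {i}"
    proof -
      have "p i \<noteq> c" "p i \<noteq> q" using i c q by blast+
      moreover have "p i \<noteq> r j" if "j \<in> {1..n}" for j using r(1)[OF that] i by (metis imageI)
      moreover have "p i = p j \<longleftrightarrow> j = i" if "j \<in> {1..n}" for j using inj_on_eq_iff[OF inj i that] by blast
      ultimately have "p i \<in> set (P j) \<longleftrightarrow> j = i" if "j \<in> {1..n}" for j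
        using that by (simp add: P_def)
      then show ?thesis using i by blast
    qed
    then show "(?g \<circ> p) i = w (t i) * N (p i - r i)"
      using i by (simp add: parent_p edge_length_eq)
  qed
  also have "(\<Sum>v\<in>r ` {1..n} - {c}. ?g v) =
    (\<Sum>v\<in>r ` {1..n} - {c}. w (\<Sum>i\<in>{i \<in> {1..n}. r i = v}. t i) * N (v - c))"
  proof (rule sum.cong[OF refl])
    fix v assume v: "v \<in> r ` {1..n} - {c}"
    then obtain j where j: "j \<in> {1..n}" "v = r j" "v \<noteq> c" by blast
    have "v \<noteq> q" using r(2) j by blast
    moreover have "v \<noteq> p i" if "i \<in> {1..n}" for i using r(1)[OF j(1)] j(2) that by (metis imageI)
    ultimately have "v \<in> set (P i) \<longleftrightarrow> r i = v" if "i \<in> {1..n}" for i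
      using that j(3) by (auto simp: P_def)
    then have "{i \<in> {1..n}. v \<in> set (P i)} = {i \<in> {1..n}. r i = v}" by blast
    moreover have "parent v = c" using v parent_r by auto
    ultimately show "?g v = w (\<Sum>i\<in>{i \<in> {1..n}. r i = v}. t i) * N (v - c)"
      by (simp only: edge_length_eq)
  qed
  finally show "gilbert_cost N w n p t q (relay_verts n p q c r) (relay_edges n p q c r) =
      w (\<Sum>i\<in>{1..n}. t i) * N (c - q) + (\<Sum>i\<in>{1..n}. w (t i) * N (p i - r i)) +
      (\<Sum>v\<in>r ` {1..n} - {c}. w (\<Sum>i\<in>{i \<in> {1..n}. r i = v}. t i) * N (v - c))"
    unfolding edges unfolding V_def by (simp only: add.assoc)
qed

lemma (in minkowski_space) hub_star:
  assumes n: "n \<ge> 1" and inj: "inj_on p {1..n}" and q: "q \<notin> p ` {1..n}"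
    and c: "c \<notin> p ` {1..n}" "c \<noteq> q"
  shows "gilbert_arborescence n p q (relay_verts n p q c (\<lambda>_. c)) (relay_edges n p q c (\<lambda>_. c))"
    and "gilbert_cost N w n p t q (relay_verts n p q c (\<lambda>_. c)) (relay_edges n p q c (\<lambda>_. c)) =
      w (\<Sum>i\<in>{1..n}. t i) * N (c - q) + (\<Sum>i\<in>{1..n}. w (t i) * N (p i - c))"
proof -
  show "gilbert_arborescence n p q (relay_verts n p q c (\<lambda>_. c)) (relay_edges n p q c (\<lambda>_. c))"
    using c by (intro relay_star(1)[OF n inj q]) simp_all
  have "(\<lambda>_. c) ` {1..n} - {c} = {}" by auto
  then show "gilbert_cost N w n p t q (relay_verts n p q c (\<lambda>_. c)) (relay_edges n p q c (\<lambda>_. c)) =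
      w (\<Sum>i\<in>{1..n}. t i) * N (c - q) + (\<Sum>i\<in>{1..n}. w (t i) * N (p i - c))"
    using relay_star(2)[OF n inj q c c, of w t] by (simp only: sum.empty add_0_right)
qed

section \<open>The lower bound by calibration\<close>

text \<open>Here \<open>g\<close> orients the edges in the direction of the path. Distinctness of the vertices makes
  the edges of the path distinct, so that the sum over the edge set telescopes.\<close>

lemma sum_path_edges_telescope:
  fixes g :: "'a::ab_group_add set \<Rightarrow> 'a"
  assumes "xs \<noteq> []" "distinct xs"
    and "\<And>A x y B. xs = A @ x # y # B \<Longrightarrow> g {x, y} = x - y"
  shows "sum g (path_edges xs) = hd xs - last xs"
  using assms
proof (induction xs rule: induct_list012)
  case (3 x y zs)
  have "finite (path_edges (y # zs))"
    by (rule finite_subset[of _ "Pow (set (y # zs))"]) (use path_edges_subset_set[of _ "y # zs"] in blast, simp)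
  moreover have "{x, y} \<notin> path_edges (y # zs)"
    using path_edges_subset_set[of "{x, y}" "y # zs"] 3(4) by auto
  ultimately have "sum g (path_edges (x # y # zs)) = g {x, y} + sum g (path_edges (y # zs))"
    by simp
  also have "g {x, y} = x - y" using 3(5)[of "[]"] by simp
  also have "sum g (path_edges (y # zs)) = y - last (y # zs)"
  proof -
    have "g {x', y'} = x' - y'" if "y # zs = A @ x' # y' # B" for A x' y' B
      using 3(5)[of "x # A"] that by simp
    then show ?thesis using 3(2) 3(4) by simp
  qed
  finally show ?case by simp
qed auto

lemma graph_path_suffix:
  assumes "graph_path V E u v (A @ x # B)"
  shows "graph_path V E x v (x # B)"
  using assms path_edges_append[of A x B] unfolding graph_path_def by auto

text \<open>The edge vector, oriented towards \<open>q\<close>: the end point \<open>x\<close> of the edge is the one whose path to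
  \<open>q\<close> passes through the other end point.\<close>

definition descent :: "'a::ab_group_add set \<Rightarrow> 'a set set \<Rightarrow> 'a \<Rightarrow> 'a set \<Rightarrow> 'a" where
  "descent V E q e = (SOME d. \<exists>x y. e = {x, y} \<and> tree_path V E x q = x # tree_path V E y q \<and> d = x - y)"

text \<open>The orientation is unambiguous since paths to \<open>q\<close> get shorter along it.\<close>

lemma descent_eq:
  assumes "tree_path V E x q = x # tree_path V E y q"
  shows "descent V E q {x, y} = x - y"
  unfolding descent_def
proof (rule some_equality)
  fix d assume "\<exists>x' y'. {x, y} = {x', y'} \<and> tree_path V E x' q = x' # tree_path V E y' q \<and> d = x' - y'"
  then obtain x' y' where d: "{x, y} = {x', y'}" "tree_path V E x' q = x' # tree_path V E y' q"
    "d = x' - y'" by blast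
  have "\<not> (x' = y \<and> y' = x)"
  proof
    assume "x' = y \<and> y' = x"
    then have "length (tree_path V E y q) = Suc (length (tree_path V E x q))" using d(2) by simp
    then show False using assms by simp
  qed
  then show "d = x - y" using d(1,3) by (auto simp: doubleton_eq_iff)
qed (use assms in blast)

text \<open>All paths to \<open>q\<close> traverse an edge in the same direction, because suffixes of such paths are
  again tree paths.\<close>

lemma descent_on_path:
  assumes "is_tree V E" "u \<in> V" "q \<in> V" "tree_path V E u q = A @ x # y # B"
  shows "descent V E q {x, y} = x - y"
proof (rule descent_eq)
  have "graph_path V E u q (A @ x # y # B)" using tree_path[OF assms(1-3)] assms(4) by simp
  then have x: "graph_path V E x q (x # y # B)" by (rule graph_path_suffix)
  then have "graph_path V E y q (y # B)" using graph_path_suffix[of V E x q "[x]"] by simp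
  then show "tree_path V E x q = x # tree_path V E y q"
    using x tree_path_eqI[OF assms(1)] by simp
qed

lemma path_edge_split:
  assumes "e \<in> path_edges xs"
  obtains A x y B where "xs = A @ x # y # B" "e = {x, y}"
proof -
  obtain i where i: "e = {xs ! i, xs ! Suc i}" "Suc i < length xs"
    using assms unfolding path_edges_def by blast
  then have "xs = take i xs @ xs ! i # xs ! Suc i # drop (Suc (Suc i)) xs"
    by (metis Cons_nth_drop_Suc Suc_lessD append_take_drop_id)
  then show ?thesis using that i(1) by blast
qed

context minkowski_space
begin

text \<open>The functional \<open>\<Sum>i\<in>I. a i\<close> calibrates an edge used by the sources in \<open>I\<close>. Exchanging the
  sums over edges and sources collapses the contribution of source \<open>i\<close> to \<open>a i \<bullet> (p i - q)\<close>, however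
  the arborescence branches.\<close>

lemma calibration_lower_bound:
  assumes arb: "gilbert_arborescence n p q V E"
    and calib: "\<And>I. I \<subseteq> {1..n} \<Longrightarrow> dual_norm N (\<Sum>i\<in>I. a i) \<le> w (\<Sum>i\<in>I. t i)"
  shows "(\<Sum>i\<in>{1..n}. a i \<bullet> (p i - q)) \<le> gilbert_cost N w n p t q V E"
proof -
  have tree: "is_tree V E" and q: "q \<in> V" and p: "\<And>i. i \<in> {1..n} \<Longrightarrow> p i \<in> V"
    and used: "\<And>e. e \<in> E \<Longrightarrow> \<exists>i\<in>{1..n}. e \<in> path_edges (tree_path V E (p i) q)"
    using arb unfolding gilbert_arborescence_def by auto
  define P where "P i = tree_path V E (p i) q" for i
  define S where "S e = {i \<in> {1..n}. e \<in> path_edges (P i)}" for e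
  let ?d = "descent V E q"
  have P: "graph_path V E (p i) q (P i)" if "i \<in> {1..n}" for i
    unfolding P_def using tree_path[OF tree p[OF that] q] .
  have on_path: "?d {x, y} = x - y" if "i \<in> {1..n}" "P i = A @ x # y # B" for i A x y B
    using descent_on_path[OF tree p[OF that(1)] q] that(2) unfolding P_def by blast
  have len: "edge_length N e = N (?d e)" if e: "e \<in> E" for e
  proof -
    obtain i where i: "i \<in> {1..n}" "e \<in> path_edges (P i)"
      using used[OF e] unfolding P_def by blast
    then obtain A x y B where "P i = A @ x # y # B" "e = {x, y}"
      using path_edge_split by metis
    then show ?thesis using on_path[OF i(1)] edge_length_eq by simp
  qed
  have telescope: "sum ?d (path_edges (P i)) = p i - q" if i: "i \<in> {1..n}" for i
    using sum_path_edges_telescope[of "P i" ?d] P[OF i] on_path[OF i]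
    unfolding graph_path_def by auto
  have "(\<Sum>i\<in>{1..n}. a i \<bullet> (p i - q)) = (\<Sum>i\<in>{1..n}. \<Sum>e\<in>{e \<in> E. e \<in> path_edges (P i)}. a i \<bullet> ?d e)"
  proof (rule sum.cong[OF refl])
    fix i assume i: "i \<in> {1..n}"
    have "{e \<in> E. e \<in> path_edges (P i)} = path_edges (P i)"
      using P[OF i] unfolding graph_path_def by auto
    then show "a i \<bullet> (p i - q) = (\<Sum>e\<in>{e \<in> E. e \<in> path_edges (P i)}. a i \<bullet> ?d e)"
      by (simp add: telescope[OF i, symmetric] inner_sum_right)
  qed
  also have "\<dots> = (\<Sum>e\<in>E. \<Sum>i\<in>S e. a i \<bullet> ?d e)"
    unfolding S_def by (rule sum.swap_restrict) (use is_tree_finite_edges[OF tree] in auto)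
  also have "\<dots> \<le> (\<Sum>e\<in>E. w (edge_flow n p t q V E e) * edge_length N e)"
  proof (rule sum_mono)
    fix e assume e: "e \<in> E"
    have "(\<Sum>i\<in>S e. a i \<bullet> ?d e) = (\<Sum>i\<in>S e. a i) \<bullet> ?d e" by (simp add: inner_sum_left)
    also have "\<dots> \<le> dual_norm N (\<Sum>i\<in>S e. a i) * N (?d e)" by (rule inner_le_dual_norm)
    also have "\<dots> \<le> w (\<Sum>i\<in>S e. t i) * N (?d e)"
      by (intro mult_right_mono calib) (auto simp: S_def)
    finally show "(\<Sum>i\<in>S e. a i \<bullet> ?d e) \<le> w (edge_flow n p t q V E e) * edge_length N e"
      using len[OF e] by (simp add: S_def P_def edge_flow_def)
  qed
  finally show ?thesis by (simp add: gilbert_cost_def)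
qed

end

section \<open>Optimality of the star\<close>

text \<open>A slightly displaced Steiner point is different from every terminal, so the perturbed graphs
  are trees on the intended vertices.\<close>

lemma eventually_scaleR_notin:
  fixes u :: "'a::real_normed_vector"
  assumes "finite F" "0 \<notin> F"
  shows "eventually (\<lambda>e. e *\<^sub>R u \<notin> F) (at_right 0)"
proof -
  have "((\<lambda>e. e *\<^sub>R u) \<longlongrightarrow> 0 *\<^sub>R u) (at_right 0)" by (intro tendsto_intros)
  moreover have "open (- F)" using assms(1) by (simp add: finite_imp_closed open_Compl)
  ultimately have "eventually (\<lambda>e. e *\<^sub>R u \<in> - F) (at_right 0)"
    using assms(2) by (intro topological_tendstoD) auto
  then show ?thesis by simp
qed

lemma star_eq_relay:
  "star_verts n p q = relay_verts n p q 0 (\<lambda>_. 0)" "star_edges n p q = relay_edges n p q 0 (\<lambda>_. 0)"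
  by (auto simp: star_verts_def relay_verts_def star_edges_def relay_edges_def insert_commute)

locale star_configuration = smooth_minkowski_space N for N :: "real ^ 'k \<Rightarrow> real" +
  fixes w :: "real \<Rightarrow> real" and n :: nat and p :: "nat \<Rightarrow> real ^ 'k" and t :: "nat \<Rightarrow> real"
    and q :: "real ^ 'k"
  assumes n: "n \<ge> 1" and inj: "inj_on p {1..n}" and q_notin: "q \<notin> p ` {1..n}"
    and p_nz: "\<And>i. i \<in> {1..n} \<Longrightarrow> p i \<noteq> 0" and q_nz: "q \<noteq> 0"
begin

abbreviation total_pull :: "nat set \<Rightarrow> real ^ 'k" where
  "total_pull I \<equiv> \<Sum>i\<in>I. w (t i) *\<^sub>R dual_vector N (p i)"

abbreviation star_cost :: real where
  "star_cost \<equiv> gilbert_cost N w n p t q (star_verts n p q) (star_edges n p q)"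

lemma zero_notin: "0 \<notin> p ` {1..n} \<union> {q}"
  using p_nz q_nz by fastforce

lemma star_gilbert_arborescence:
  "gilbert_arborescence n p q (star_verts n p q) (star_edges n p q)"
  unfolding star_eq_relay using zero_notin by (intro hub_star(1)[OF n inj q_notin]) auto

lemma star_cost:
  "star_cost = w (\<Sum>i\<in>{1..n}. t i) * N q + (\<Sum>i\<in>{1..n}. w (t i) * N (p i))"
  unfolding star_eq_relay using hub_star(2)[OF n inj q_notin, of 0 w t] zero_notin by simp

text \<open>With \<open>a i = w (t i) *\<^sub>R dual_vector N (p i)\<close> the lower bound is attained by the star: the parts
  \<open>a i \<bullet> p i\<close> are the costs of the edges at the sources, and by balance \<open>- (\<Sum>i. a i) \<bullet> q\<close> is the
  cost of the edge at the sink.\<close>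

lemma conditions_imp_minimum:
  assumes balance: "total_pull {1..n} + w (\<Sum>i\<in>{1..n}. t i) *\<^sub>R dual_vector N q = 0"
    and bound: "\<And>I. I \<subseteq> {1..n} \<Longrightarrow> dual_norm N (total_pull I) \<le> w (\<Sum>i\<in>I. t i)"
  shows "minimum_gilbert_arborescence N w n p t q (star_verts n p q) (star_edges n p q)"
  unfolding minimum_gilbert_arborescence_def
proof (intro conjI allI impI star_gilbert_arborescence)
  fix V E assume "gilbert_arborescence n p q V E"
  then have "(\<Sum>i\<in>{1..n}. (w (t i) *\<^sub>R dual_vector N (p i)) \<bullet> (p i - q)) \<le> gilbert_cost N w n p t q V E"
    by (rule calibration_lower_bound) (rule bound)
  moreover have "(\<Sum>i\<in>{1..n}. (w (t i) *\<^sub>R dual_vector N (p i)) \<bullet> (p i - q)) = star_cost"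
  proof -
    have "(\<Sum>i\<in>{1..n}. (w (t i) *\<^sub>R dual_vector N (p i)) \<bullet> (p i - q)) =
        (\<Sum>i\<in>{1..n}. w (t i) * (dual_vector N (p i) \<bullet> p i)) - total_pull {1..n} \<bullet> q"
      by (simp add: inner_diff_right sum_subtractf inner_sum_left right_diff_distrib)
    also have "(\<Sum>i\<in>{1..n}. w (t i) * (dual_vector N (p i) \<bullet> p i)) = (\<Sum>i\<in>{1..n}. w (t i) * N (p i))"
      using dual_vector(2) p_nz by (intro sum.cong) auto
    also have "total_pull {1..n} = - (w (\<Sum>i\<in>{1..n}. t i) *\<^sub>R dual_vector N q)"
      using balance by (simp add: eq_neg_iff_add_eq_0)
    finally show ?thesis by (simp add: star_cost dual_vector(2)[OF q_nz])
  qed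
  ultimately show "star_cost \<le> gilbert_cost N w n p t q V E" by simp
qed

text \<open>Compare the star with the star centred at \<open>e *\<^sub>R u\<close>.\<close>

lemma minimum_imp_balance:
  assumes min: "minimum_gilbert_arborescence N w n p t q (star_verts n p q) (star_edges n p q)"
  shows "total_pull {1..n} + w (\<Sum>i\<in>{1..n}. t i) *\<^sub>R dual_vector N q = 0"
proof -
  \<comment> \<open>Index \<open>0\<close> stands for the sink, so that all terminals are treated alike.\<close>
  define x where "x i = (if i = 0 then q else p i)" for i
  define c where "c i = (if i = 0 then w (\<Sum>i\<in>{1..n}. t i) else w (t i))" for i
  have split: "(\<Sum>i\<in>insert 0 {1..n}. g (c i) (x i)) =
      g (w (\<Sum>i\<in>{1..n}. t i)) q + (\<Sum>i\<in>{1..n}. g (w (t i)) (p i))"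
    for g :: "real \<Rightarrow> real ^ 'k \<Rightarrow> 'c :: ab_group_add"
  proof -
    have "(\<Sum>i\<in>{1..n}. g (c i) (x i)) = (\<Sum>i\<in>{1..n}. g (w (t i)) (p i))"
      by (intro sum.cong) (auto simp: c_def x_def)
    then show ?thesis by (subst sum.insert) (auto simp: c_def x_def)
  qed
  let ?z = "\<Sum>i\<in>insert 0 {1..n}. c i *\<^sub>R dual_vector N (x i)"
  have "?z \<bullet> u \<le> 0" for u
  proof (rule first_variation)
    show "x i \<noteq> 0" if "i \<in> insert 0 {1..n}" for i
      using that p_nz q_nz by (auto simp: x_def)
    have "eventually (\<lambda>e. e *\<^sub>R u \<notin> p ` {1..n} \<union> {q}) (at_right 0)"
      using zero_notin by (intro eventually_scaleR_notin) auto
    then show "eventually (\<lambda>e. (\<Sum>i\<in>insert 0 {1..n}. c i * N (x i)) \<le>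
        (\<Sum>i\<in>insert 0 {1..n}. c i * N (x i - e *\<^sub>R u)) + e * 0) (at_right 0)"
    proof eventually_elim
      case (elim e)
      let ?V = "relay_verts n p q (e *\<^sub>R u) (\<lambda>_. e *\<^sub>R u)"
      let ?E = "relay_edges n p q (e *\<^sub>R u) (\<lambda>_. e *\<^sub>R u)"
      have "gilbert_arborescence n p q ?V ?E"
        using elim by (intro hub_star(1)[OF n inj q_notin]) auto
      then have "star_cost \<le> gilbert_cost N w n p t q ?V ?E"
        using min unfolding minimum_gilbert_arborescence_def by blast
      also have "\<dots> = w (\<Sum>i\<in>{1..n}. t i) * N (e *\<^sub>R u - q) + (\<Sum>i\<in>{1..n}. w (t i) * N (p i - e *\<^sub>R u))"
        using elim by (intro hub_star(2)[OF n inj q_notin]) auto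
      finally show ?case
        using split[of "\<lambda>c x. c * N x"] split[of "\<lambda>c x. c * N (x - e *\<^sub>R u)"]
        by (simp add: star_cost N_minus_commute)
    qed
  qed auto
  \<comment> \<open>The choice \<open>u = ?z\<close> turns the inequality into \<open>?z \<bullet> ?z \<le> 0\<close>.\<close>
  from this[of ?z] have "?z = 0" by (meson inner_eq_zero_iff inner_ge_zero order_antisym)
  then show ?thesis using split[of "\<lambda>c x. c *\<^sub>R dual_vector N x"] by (simp add: add.commute)
qed

text \<open>Compare the star with the tree in which the sources in \<open>I\<close> first meet at \<open>e *\<^sub>R u\<close>. The new
  edge from there to the origin contributes the term \<open>w (\<Sum>i\<in>I. t i) * N u\<close>.\<close>

lemma minimum_imp_dual_norm_le:
  assumes min: "minimum_gilbert_arborescence N w n p t q (star_verts n p q) (star_edges n p q)"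
    and I: "I \<subseteq> {1..n}" "I \<noteq> {}" and w: "w (\<Sum>i\<in>I. t i) \<ge> 0"
  shows "dual_norm N (total_pull I) \<le> w (\<Sum>i\<in>I. t i)"
proof (rule dual_norm_leI[OF _ w])
  fix u
  show "total_pull I \<bullet> u \<le> w (\<Sum>i\<in>I. t i) * N u"
  proof (cases "u = 0")
    case False
    show ?thesis
    proof (rule first_variation)
      show "finite I" using I(1) finite_subset by blast
      show "p i \<noteq> 0" if "i \<in> I" for i using that I(1) p_nz by blast
      have "eventually (\<lambda>e. e *\<^sub>R u \<notin> p ` {1..n} \<union> {q}) (at_right 0)"
        using zero_notin by (intro eventually_scaleR_notin) auto
      moreover have "eventually (\<lambda>e :: real. e > 0) (at_right 0)"
        by (simp add: eventually_at_right_less)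
      ultimately show "eventually (\<lambda>e. (\<Sum>i\<in>I. w (t i) * N (p i)) \<le>
          (\<Sum>i\<in>I. w (t i) * N (p i - e *\<^sub>R u)) + e * (w (\<Sum>i\<in>I. t i) * N u)) (at_right 0)"
      proof eventually_elim
        case (elim e)
        define r where "r i = (if i \<in> I then e *\<^sub>R u else 0)" for i
        let ?V = "relay_verts n p q 0 r"
        let ?E = "relay_edges n p q 0 r"
        have r: "r i \<notin> p ` {1..n}" "r i \<noteq> q" for i
          using elim zero_notin by (auto simp: r_def)
        have "gilbert_arborescence n p q ?V ?E"
          using r zero_notin q_notin by (intro relay_star[OF n inj]) auto
        then have "star_cost \<le> gilbert_cost N w n p t q ?V ?E"
          using min unfolding minimum_gilbert_arborescence_def by blast
        also have "\<dots> = w (\<Sum>i\<in>{1..n}. t i) * N q + (\<Sum>i\<in>{1..n}. w (t i) * N (p i - r i))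
            + w (\<Sum>i\<in>I. t i) * N (e *\<^sub>R u)"
        proof -
          have nz: "e *\<^sub>R u \<noteq> 0" using elim False by simp
          have "r ` {1..n} - {0} = {e *\<^sub>R u}"
            using I nz by (auto simp: r_def image_iff)
          moreover have "{i \<in> {1..n}. r i = e *\<^sub>R u} = I"
            using I nz by (auto simp: r_def)
          ultimately show ?thesis
            by (subst relay_star(2)[OF n inj q_notin]) (use zero_notin r in auto)
        qed
        finally have "(\<Sum>i\<in>{1..n}. w (t i) * N (p i)) \<le>
            (\<Sum>i\<in>{1..n}. w (t i) * N (p i - r i)) + w (\<Sum>i\<in>I. t i) * (e * N u)"
          using elim by (simp add: star_cost N_scaleR)
        moreover have "(\<Sum>i\<in>{1..n}. w (t i) * N (p i)) =
            (\<Sum>i\<in>{1..n} - I. w (t i) * N (p i)) + (\<Sum>i\<in>I. w (t i) * N (p i))"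
          using I(1) by (intro sum.subset_diff) auto
        moreover have "(\<Sum>i\<in>{1..n}. w (t i) * N (p i - r i)) =
            (\<Sum>i\<in>{1..n} - I. w (t i) * N (p i)) + (\<Sum>i\<in>I. w (t i) * N (p i - e *\<^sub>R u))"
          using I(1) by (subst sum.subset_diff[of I]) (auto simp: r_def intro!: sum.cong)
        ultimately show ?case by (simp add: mult.left_commute)
      qed
    qed
  qed simp
qed

end

section \<open>The characterization\<close>

theorem theorem1:
  fixes N :: "real ^ 'k \<Rightarrow> real"
    and w :: "real \<Rightarrow> real"
    and n :: nat
    and p :: "nat \<Rightarrow> real ^ 'k"
    and t :: "nat \<Rightarrow> real"
    and q :: "real ^ 'k"
  assumes "smooth_minkowski_space N"
    and "weight_function w"
    and "n \<ge> 1"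
    and "inj_on p {1..n}"
    and "q \<notin> p ` {1..n}"
    and "\<And>i. i \<in> {1..n} \<Longrightarrow> p i \<noteq> 0"
    and "q \<noteq> 0"
    and "\<And>i. i \<in> {1..n} \<Longrightarrow> t i > 0"
  shows "minimum_gilbert_arborescence N w n p t q (star_verts n p q) (star_edges n p q) \<longleftrightarrow>
    (\<Sum>i\<in>{1..n}. w (t i) *\<^sub>R dual_vector N (p i))
        + w (\<Sum>i\<in>{1..n}. t i) *\<^sub>R dual_vector N q = 0 \<and>
    (\<forall>I\<subseteq>{1..n}. dual_norm N (\<Sum>i\<in>I. w (t i) *\<^sub>R dual_vector N (p i)) \<le> w (\<Sum>i\<in>I. t i))"
    (is "?min \<longleftrightarrow> ?balance \<and> ?bound")
proof -
  interpret smooth_minkowski_space N by fact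
  interpret star_configuration N w n p t q
    using assms by unfold_locales
  show ?thesis
  proof
    assume min: ?min
    have "dual_norm N (total_pull I) \<le> w (\<Sum>i\<in>I. t i)" if I: "I \<subseteq> {1..n}" for I
    \<comment> \<open>The empty flow splits off nothing; here the bound is just \<open>0 \<le> w 0\<close>.\<close>
    proof (cases "I = {}")
      case True
      have "w 0 \<ge> 0" using assms(2) by (simp add: weight_function_def)
      then show ?thesis using True by (auto intro: dual_norm_leI)
    next
      case False
      have "(\<Sum>i\<in>I. t i) > 0"
        using I False assms(8) finite_subset[OF I] by (intro sum_pos) auto
      then have "w (\<Sum>i\<in>I. t i) \<ge> 0"
        using assms(2) unfolding weight_function_def by (simp add: less_imp_le)
      then show ?thesis by (rule minimum_imp_dual_norm_le[OF min I False])
    qed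
    then show "?balance \<and> ?bound" using minimum_imp_balance[OF min] by blast
  next
    assume "?balance \<and> ?bound"
    then show ?min by (intro conditions_imp_minimum) auto
  qed
qed

end
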